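(* Let $\mathcal{A}$ be a finite alphabet and let $n\ge 1$. (1) A subset $X\subseteq\mathcal{A}^{\mathbb{N}}$ has an $n$-fold interleaving factorization, i.e. there exist sets $X_0,\dots,X_{n-1}\subseteq\mathcal{A}^{\mathbb{N}}$ with $X=X_0\circledast X_1\circledast\cdots\circledast X_{n-1}$, if and only if $X=X^{[n]}$. (2) If $X=X_0\circledast X_1\circledast\cdots\circledast X_{n-1}$ has an $n$-fold interleaving factorization, then its ordered set of $n$-fold interleaving factors is unique, given by its principal decimations $X_i=\psi_{i,n}(X)$ for $0\le i\le n-1$.
   Context: $\mathbb{N}=\{0,1,2,\dots\}$. For $\mathbf{x}=a_0a_1a_2\cdots\in\mathcal{A}^{\mathbb{N}}$, $i\ge0$, $n\ge1$, the decimation is $\psi_{i,n}(\mathbf{x})=a_ia_{i+n}a_{i+2n}\cdots$, and for a set $X\subseteq\mathcal{A}^{\mathbb{N}}$, $\psi_{i,n}(X)=\{\psi_{i,n}(\mathbf{x}):\mathbf{x}\in X\}$; the principal decimations at level $n$ are those with $0\le i\le n-1$. The $n$-fold interleaving of sequences $\mathbf{x}_i=a_{i,0}a_{i,1}a_{i,2}\cdots$ ($0\le i\le n-1$) is $\mathbf{x}_0\circledast\cdots\circledast\mathbf{x}_{n-1}=b_0b_1b_2\cdots$ with $b_{i+jn}=a_{i,j}$ for $0\le i\le n-1$, $j\ge0$. The $n$-fold interleaving of sets $X_0,\dots,X_{n-1}\subseteq\mathcal{A}^{\mathbb{N}}$ is $X_0\circledast\cdots\circledast X_{n-1}=(\circledast_n)_{i=0}^{n-1}X_i=\{\mathbf{x}_0\circledast\cdots\circledast\mathbf{x}_{n-1}:\mathbf{x}_i\in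 X_i\text{ for all }i\}$; the sets $X_i$ are called the $n$-fold interleaving factors. The $n$-fold interleaving closure of $X$ is $X^{[n]}=(\circledast_n)_{i=0}^{n-1}\psi_{i,n}(X)$.
   Formalization: Part (2) is stated only for X nonempty or n = 1: for X empty and n ≥ 2 the factors are not unique, since the interleaving of the empty set with any set is empty. *)

theory Defs
  imports Main
begin

text \<open>One-sided infinite words over the alphabet \<open>'a\<close> are functions \<open>nat \<Rightarrow> 'a\<close>.\<close>

definition decimation :: "nat \<Rightarrow> nat \<Rightarrow> (nat \<Rightarrow> 'a) \<Rightarrow> (nat \<Rightarrow> 'a)" where
  "decimation i n x = (\<lambda>j. x (i + j * n))"

definition decimation_set :: "nat \<Rightarrow> nat \<Rightarrow> (nat \<Rightarrow> 'a) set \<Rightarrow> (nat \<Rightarrow> 'a) set" where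
  "decimation_set i n X = decimation i n ` X"

text \<open>A family indexed by \<open>0, \<dots>, n - 1\<close> is a function on \<open>nat\<close> of which only the values at
  indices below \<open>n\<close> matter. For \<open>n \<ge> 1\<close>, position \<open>k\<close> is uniquely \<open>i + j * n\<close> with \<open>i < n\<close>,
  namely \<open>i = k mod n\<close> and \<open>j = k div n\<close>; see \<open>interleave_nth\<close> below.\<close>

definition interleave :: "nat \<Rightarrow> (nat \<Rightarrow> nat \<Rightarrow> 'a) \<Rightarrow> (nat \<Rightarrow> 'a)" where
  "interleave n xs = (\<lambda>k. xs (k mod n) (k div n))"

lemma interleave_nth: "i < n \<Longrightarrow> interleave n xs (i + j * n) = xs i j"
  by (simp add: interleave_def)

definition interleave_sets :: "nat \<Rightarrow> (nat \<Rightarrow> (nat \<Rightarrow> 'a) set) \<Rightarrow> (nat \<Rightarrow> 'a) set" where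
  "interleave_sets n Xs = {interleave n xs | xs. \<forall>i<n. xs i \<in> Xs i}"

definition interleaving_closure :: "nat \<Rightarrow> (nat \<Rightarrow> 'a) set \<Rightarrow> (nat \<Rightarrow> 'a) set" where
  "interleaving_closure n X = interleave_sets n (\<lambda>i. decimation_set i n X)"

end

theory Submission
  imports Defs
begin

text \<open>Splitting positions by residue mod \<open>n\<close> identifies words with
  \<open>n\<close>-tuples of words: \<open>interleave\<close> assembles the tuple and
  \<open>decimation i n\<close> is its \<open>i\<close>-th coordinate. So
  \<open>interleave_sets\<close> is a Cartesian product and \<open>decimation_set\<close> a
  projection. A nonempty product has its factors as projections
  (\<open>decimation_set_interleave_sets\<close>), hence it is the product of its projections
  (\<open>interleaving_closure_interleave_sets\<close>).\<close>

lemma decimation_interleave: "i < n \<Longrightarrow> decimation i n (interleave n xs) = xs i"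
  by (simp add: decimation_def interleave_nth)

lemma interleave_sets_cong:
  "(\<And>i. i < n \<Longrightarrow> Xs i = Ys i) \<Longrightarrow> interleave_sets n Xs = interleave_sets n Ys"
  by (simp add: interleave_sets_def)

lemma interleave_sets_empty: "i < n \<Longrightarrow> Xs i = {} \<Longrightarrow> interleave_sets n Xs = {}"
  by (auto simp: interleave_sets_def)

text \<open>Nonemptiness of the other factors lets any point of \<open>Xs i\<close> extend to a full
  tuple; \<open>Xs i\<close> itself may be empty.\<close>

lemma decimation_set_interleave_sets:
  assumes "i < n" and others: "\<And>j. j < n \<Longrightarrow> j \<noteq> i \<Longrightarrow> Xs j \<noteq> {}"
  shows "decimation_set i n (interleave_sets n Xs) = Xs i"
proof
  show "decimation_set i n (interleave_sets n Xs) \<subseteq> Xs i"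
    using assms(1) by (auto simp: decimation_set_def interleave_sets_def decimation_interleave)
next
  show "Xs i \<subseteq> decimation_set i n (interleave_sets n Xs)"
  proof
    fix y assume y: "y \<in> Xs i"
    \<comment> \<open>Coordinate \<open>i\<close> is the prescribed word; the others are filled by
      choice.\<close>
    define xs where "xs = (\<lambda>j. if j = i then y else (SOME x. x \<in> Xs j))"
    have "\<forall>j<n. xs j \<in> Xs j"
      using y others by (simp add: xs_def some_in_eq)
    then have "interleave n xs \<in> interleave_sets n Xs"
      by (auto simp: interleave_sets_def)
    moreover have "decimation i n (interleave n xs) = y"
      using assms(1) by (simp add: decimation_interleave xs_def)
    ultimately show "y \<in> decimation_set i n (interleave_sets n Xs)"
      unfolding decimation_set_def by blast
  qed
qed

lemma interleaving_closure_interleave_sets: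
  assumes "n \<ge> 1"
  shows "interleaving_closure n (interleave_sets n Xs) = interleave_sets n Xs"
proof (cases "\<exists>i<n. Xs i = {}")
  \<comment> \<open>Projections may fail to recover the factors here, but the product and its
    closure are both empty.\<close>
  case True
  then have "interleave_sets n Xs = {}"
    using interleave_sets_empty by blast
  moreover have "interleaving_closure n {} = {}"
    unfolding interleaving_closure_def
    by (rule interleave_sets_empty[of 0]) (use assms in \<open>auto simp: decimation_set_def\<close>)
  ultimately show ?thesis by simp
next
  case False
  then show ?thesis
    unfolding interleaving_closure_def
    by (intro interleave_sets_cong decimation_set_interleave_sets) auto
qed

text \<open>Uniqueness excludes empty \<open>X\<close> with \<open>n \<ge> 2\<close>: one empty
  factor empties the product, leaving the others arbitrary.\<close>

theorem theorem2p8: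
  fixes X :: "(nat \<Rightarrow> 'a::finite) set" and n :: nat
  assumes "n \<ge> 1"
  shows "((\<exists>Xs. X = interleave_sets n Xs) \<longleftrightarrow> X = interleaving_closure n X) \<and>
         (\<forall>Xs. X = interleave_sets n Xs \<and> (X \<noteq> {} \<or> n = 1) \<longrightarrow>
            (\<forall>i<n. Xs i = decimation_set i n X))"
proof (intro conjI allI impI)
  show "(\<exists>Xs. X = interleave_sets n Xs) \<longleftrightarrow> X = interleaving_closure n X"
    using interleaving_closure_interleave_sets[OF assms] interleaving_closure_def by metis
next
  fix Xs i
  assume X: "X = interleave_sets n Xs \<and> (X \<noteq> {} \<or> n = 1)" and "i < n"
  \<comment> \<open>An empty \<open>Xs j\<close> would make \<open>X\<close> empty, forcing
    \<open>n = 1\<close>, which leaves no room for two distinct indices.\<close>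
  then have "Xs j \<noteq> {}" if "j < n" "j \<noteq> i" for j
    using that interleave_sets_empty[of j n Xs] by auto
  with X \<open>i < n\<close> show "Xs i = decimation_set i n X"
    by (simp add: decimation_set_interleave_sets)
qed

end
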